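(* Let $(\mathcal{A},\bullet,\omega)$ be a pre-symplectic left-symmetric algebra over $\mathbb{K}$ such that the commutator ideal $[\mathcal{A},\mathcal{A}]$ is nondegenerate with respect to $\omega$. Then $(\mathcal{A},\bullet,\omega)$ is a Milnor pre-symplectic algebra by means of $I:=\mathcal{A}\bullet\mathcal{A}=[\mathcal{A},\mathcal{A}]$ (in particular the two subspaces $\mathcal{A}\bullet\mathcal{A}$ and $[\mathcal{A},\mathcal{A}]$ coincide), and the following hold: (i) $\bullet$ vanishes identically on $I\times I$ and on $I^\perp\times I^\perp$; thus $I$ is an abelian ideal of the Lie algebra $\mathcal{A}^-$ and $I^\perp$ is an abelian Lie subalgebra of $\mathcal{A}^-$; (ii) $\mathcal{A}=I\oplus I^\perp$, and $\mathrm{L}_u^\bullet=0$ for $u\in I$, while $\mathrm{L}_u^\bullet=\mathrm{ad}_u$ for $u\in I^\perp$; (iii) the center of $\mathcal{A}^-$ is $Z(\mathcal{A}^-)=\{u\in\mathcal{A}: \mathrm{L}^\bullet_u=\mathrm{R}^\bullet_u=0\}$; and $(\mathcal{A},\bullet)$ is a Novikov algebra.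
   Context: $\mathbb{K}$ is a field of characteristic $0$; all vector spaces are finite-dimensional. For an algebra $(\mathcal{A},\bullet)$ (bilinear product): $\mathrm{L}^\bullet_u(v)=u\bullet v$, $\mathrm{R}^\bullet_u(v)=v\bullet u$, $[u,v]_\bullet=u\bullet v-v\bullet u$, $\mathrm{ad}_u=\mathrm{L}^\bullet_u-\mathrm{R}^\bullet_u$; $\mathcal{A}^-$ is $\mathcal{A}$ with the bracket $[\cdot,\cdot]_\bullet$; $(\mathcal{A},\bullet)$ is Lie-admissible if $\mathcal{A}^-$ is a Lie algebra. $[\mathcal{A},\mathcal{A}]=\mathrm{span}\{[u,v]_\bullet\}$ and $\mathcal{A}\bullet\mathcal{A}=\mathrm{span}\{u\bullet v\}$. With $(u,v,w)=(u\bullet v)\bullet w-u\bullet(v\bullet w)$, the algebra is left-symmetric if $(u,v,w)=(v,u,w)$ for all $u,v,w$ (then it is Lie-admissible), and Novikov if it is left-symmetric and $(u\bullet v)\bullet w=(u\bullet w)\bullet v$ for all $u,v,w$. A pre-symplectic left-symmetric algebra is a triple $(\mathcal{A},\bullet,\omega)$ with $(\mathcal{A},\bullet)$ left-symmetric and $\omega$ a nondegenerate skew-symmetric bilinear form such that $\omega(u\bullet v,w)=\omega(v,u\bullet w)$ for all $u,v,w$. For a subspace $F$, $F^\perp=\{x:\omega(x,y)=0\ \forall y\in F\}$; $F$ is nondegenerate if $F\cap F^\perp=\{0\}$. A Milnor pre-symplectic algebra (by means of $I$) is an algebra $(\mathcal{A},\bullet)$ with a nondegenerate skew-symmetric bilinear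 form $\omega$ for which all $\mathrm{L}_u^\bullet$ are symmetric ($\omega(u\bullet v,w)=\omega(v,u\bullet w)$), such that $(\mathcal{A},\bullet)$ is Lie-admissible and $I$ is a nondegenerate two-sided ideal with $\mathcal{A}\bullet\mathcal{A}\subset I$ and $\mathrm{L}_u^\bullet=0$ for all $u\in I$. *)

theory Defs
  imports Complex_Main
begin

text \<open>
  The underlying space of an algebra is a whole type \<open>'v\<close>, with the scalar multiplication
  \<open>s\<close> over the field \<open>'k\<close> as an explicit parameter.
\<close>

type_synonym ('k, 'v) scaling = "'k \<Rightarrow> 'v \<Rightarrow> 'v"
type_synonym 'v product = "'v \<Rightarrow> 'v \<Rightarrow> 'v"
type_synonym ('k, 'v) form = "'v \<Rightarrow> 'v \<Rightarrow> 'k"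

definition bilinear_map ::
    "('k::field, 'v::ab_group_add) scaling \<Rightarrow> ('k, 'w::ab_group_add) scaling \<Rightarrow> ('v \<Rightarrow> 'v \<Rightarrow> 'w) \<Rightarrow> bool" where
  "bilinear_map s t h \<longleftrightarrow>
     (\<forall>u. Vector_Spaces.linear s t (\<lambda>v. h u v)) \<and> (\<forall>v. Vector_Spaces.linear s t (\<lambda>u. h u v))"

definition L_op :: "'v product \<Rightarrow> 'v \<Rightarrow> 'v \<Rightarrow> 'v" where
  "L_op m u = (\<lambda>v. m u v)"

definition R_op :: "'v product \<Rightarrow> 'v \<Rightarrow> 'v \<Rightarrow> 'v" where
  "R_op m u = (\<lambda>v. m v u)"

definition commutator :: "'v::ab_group_add product \<Rightarrow> 'v product" where
  "commutator m u v = m u v - m v u"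

definition ad_op :: "'v::ab_group_add product \<Rightarrow> 'v \<Rightarrow> 'v \<Rightarrow> 'v" where
  "ad_op m u = (\<lambda>v. L_op m u v - R_op m u v)"

definition associator :: "'v::ab_group_add product \<Rightarrow> 'v \<Rightarrow> 'v \<Rightarrow> 'v \<Rightarrow> 'v" where
  "associator m u v w = m (m u v) w - m u (m v w)"


subsection \<open>Lie algebras\<close>

definition lie_algebra :: "('k::field, 'v::ab_group_add) scaling \<Rightarrow> 'v product \<Rightarrow> bool" where
  "lie_algebra s b \<longleftrightarrow> bilinear_map s s b \<and> (\<forall>u. b u u = 0) \<and>
     (\<forall>u v w. b u (b v w) + b v (b w u) + b w (b u v) = 0)"

definition abelian_lie_ideal :: "('k::field, 'v::ab_group_add) scaling \<Rightarrow> 'v product \<Rightarrow> 'v set \<Rightarrow> bool" where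
  "abelian_lie_ideal s b F \<longleftrightarrow> module.subspace s F \<and> (\<forall>u. \<forall>x\<in>F. b u x \<in> F) \<and>
     (\<forall>x\<in>F. \<forall>y\<in>F. b x y = 0)"

definition abelian_lie_subalgebra :: "('k::field, 'v::ab_group_add) scaling \<Rightarrow> 'v product \<Rightarrow> 'v set \<Rightarrow> bool" where
  "abelian_lie_subalgebra s b F \<longleftrightarrow> module.subspace s F \<and> (\<forall>x\<in>F. \<forall>y\<in>F. b x y \<in> F) \<and>
     (\<forall>x\<in>F. \<forall>y\<in>F. b x y = 0)"

definition lie_center :: "'v::zero product \<Rightarrow> 'v set" where
  "lie_center b = {u. \<forall>v. b u v = 0}"


subsection \<open>Classes of algebras\<close>

definition lie_admissible :: "('k::field, 'v::ab_group_add) scaling \<Rightarrow> 'v product \<Rightarrow> bool" where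
  "lie_admissible s m \<longleftrightarrow> bilinear_map s s m \<and> lie_algebra s (commutator m)"

definition left_symmetric :: "('k::field, 'v::ab_group_add) scaling \<Rightarrow> 'v product \<Rightarrow> bool" where
  "left_symmetric s m \<longleftrightarrow> bilinear_map s s m \<and>
     (\<forall>u v w. associator m u v w = associator m v u w)"

definition novikov :: "('k::field, 'v::ab_group_add) scaling \<Rightarrow> 'v product \<Rightarrow> bool" where
  "novikov s m \<longleftrightarrow> left_symmetric s m \<and> (\<forall>u v w. m (m u v) w = m (m u w) v)"

definition product_span :: "('k::field, 'v::ab_group_add) scaling \<Rightarrow> 'v product \<Rightarrow> 'v set" where
  "product_span s m = module.span s {m u v | u v. True}"

definition commutator_span :: "('k::field, 'v::ab_group_add) scaling \<Rightarrow> 'v product \<Rightarrow> 'v set" where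
  "commutator_span s m = module.span s {commutator m u v | u v. True}"

definition two_sided_ideal :: "('k::field, 'v::ab_group_add) scaling \<Rightarrow> 'v product \<Rightarrow> 'v set \<Rightarrow> bool" where
  "two_sided_ideal s m I \<longleftrightarrow> module.subspace s I \<and> (\<forall>u. \<forall>x\<in>I. m u x \<in> I \<and> m x u \<in> I)"

definition is_direct_sum :: "('k::field, 'v::ab_group_add) scaling \<Rightarrow> 'v set \<Rightarrow> 'v set \<Rightarrow> bool" where
  "is_direct_sum s F G \<longleftrightarrow> module.subspace s F \<and> module.subspace s G \<and>
     {x + y | x y. x \<in> F \<and> y \<in> G} = UNIV \<and> F \<inter> G = {0}"


subsection \<open>Skew-symmetric forms\<close>

definition nondegenerate_skew_form :: "('k::field, 'v::ab_group_add) scaling \<Rightarrow> ('k, 'v) form \<Rightarrow> bool" where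
  "nondegenerate_skew_form s \<omega> \<longleftrightarrow> bilinear_map s (*) \<omega> \<and>
     (\<forall>u v. \<omega> u v = - \<omega> v u) \<and> (\<forall>u. (\<forall>v. \<omega> u v = 0) \<longrightarrow> u = 0)"

definition perp :: "('k::zero, 'v) form \<Rightarrow> 'v set \<Rightarrow> 'v set" where
  "perp \<omega> F = {x. \<forall>y\<in>F. \<omega> x y = 0}"

definition nondegenerate_subspace ::
    "('k::field, 'v::ab_group_add) scaling \<Rightarrow> ('k, 'v) form \<Rightarrow> 'v set \<Rightarrow> bool" where
  "nondegenerate_subspace s \<omega> F \<longleftrightarrow> module.subspace s F \<and> F \<inter> perp \<omega> F = {0}"

definition symmetric_endo :: "('k, 'v) form \<Rightarrow> ('v \<Rightarrow> 'v) \<Rightarrow> bool" where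
  "symmetric_endo \<omega> f \<longleftrightarrow> (\<forall>v w. \<omega> (f v) w = \<omega> v (f w))"

definition presymplectic_left_symmetric ::
    "('k::field, 'v::ab_group_add) scaling \<Rightarrow> 'v product \<Rightarrow> ('k, 'v) form \<Rightarrow> bool" where
  "presymplectic_left_symmetric s m \<omega> \<longleftrightarrow>
     left_symmetric s m \<and> nondegenerate_skew_form s \<omega> \<and> (\<forall>u. symmetric_endo \<omega> (L_op m u))"

definition milnor_presymplectic ::
    "('k::field, 'v::ab_group_add) scaling \<Rightarrow> 'v product \<Rightarrow> ('k, 'v) form \<Rightarrow> 'v set \<Rightarrow> bool" where
  "milnor_presymplectic s m \<omega> I \<longleftrightarrow>
     bilinear_map s s m \<and> nondegenerate_skew_form s \<omega> \<and> (\<forall>u. symmetric_endo \<omega> (L_op m u)) \<and>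
     lie_admissible s m \<and> two_sided_ideal s m I \<and> nondegenerate_subspace s \<omega> I \<and>
     product_span s m \<subseteq> I \<and> (\<forall>u\<in>I. L_op m u = (\<lambda>_. 0))"

end

theory Submission
  imports Defs
begin

text \<open>
  Two facts about symmetry carry the proof. First, left symmetry says
  \<open>L_[u,v] = [L_u, L_v]\<close>. The left side is symmetric for \<open>\<omega>\<close>, and a commutator of symmetric
  operators is skew; in characteristic \<open>\<noteq> 2\<close> an operator that is both vanishes, because \<open>\<omega>\<close> is
  nondegenerate. Hence \<open>L_c = 0\<close> for every \<open>c\<close> in \<open>C = [A,A]\<close> (\<open>left_mult_commutator_span\<close>).

  Let \<open>C\<close> be nondegenerate and \<open>J\<close> its orthogonal complement. By finite dimension \<open>A = C \<oplus> J\<close>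
  (\<open>orthogonal_decomposition\<close>). As \<open>C\<close> annihilates everything from the left, \<open>u c = [u,c]\<close> lies
  in \<open>C\<close>; thus \<open>C\<close> is invariant under all \<open>L_u\<close>, and by symmetry so is \<open>J\<close>. For \<open>x, y\<close> in \<open>J\<close>
  the commutator \<open>[x,y]\<close> is in \<open>C \<inter> J = 0\<close>, so the product is commutative on \<open>J\<close>.

  The second fact is that such a product is zero (\<open>perp_product_zero\<close>): the trilinear form
  \<open>\<omega>(x y, z)\<close> on \<open>J\<close> is symmetric in \<open>x, y\<close>, and symmetry of \<open>L_x\<close> together with skewness of
  \<open>\<omega>\<close> makes it skew in \<open>y, z\<close>. A trilinear form symmetric in one pair of neighbouring
  arguments and skew in the other vanishes.

  So the only products that survive are those of an element of \<open>J\<close> with an element of \<open>C\<close>, and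
  they lie in \<open>C\<close>. All the assertions are read off from this description.
\<close>

section \<open>Bilinear maps\<close>

lemma bilinear_map_simps:
  assumes "bilinear_map s t h"
  shows "h (u + v) w = h u w + h v w" "h u (v + w) = h u v + h u w"
    "h (u - v) w = h u w - h v w" "h u (v - w) = h u v - h u w"
    "h 0 w = 0" "h u 0 = 0"
    "h (s c u) w = t c (h u w)" "h u (s c w) = t c (h u w)"
proof -
  have L: "Vector_Spaces.linear s t (h u)" for u
    using assms unfolding bilinear_map_def by simp
  have R: "Vector_Spaces.linear s t (\<lambda>u. h u w)" for w
    using assms unfolding bilinear_map_def by simp
  show "h (u + v) w = h u w + h v w" "h u (v + w) = h u v + h u w"
    "h (s c u) w = t c (h u w)" "h u (s c w) = t c (h u w)"
    using L R by (simp_all add: Vector_Spaces.linear_iff)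
  interpret l: Vector_Spaces.linear s t "h u" by (rule L)
  interpret r: Vector_Spaces.linear s t "\<lambda>u. h u w" by (rule R)
  show "h (u - v) w = h u w - h v w" "h u (v - w) = h u v - h u w" "h 0 w = 0" "h u 0 = 0"
    by (fact r.diff l.diff r.zero l.zero)+
qed

lemma bilinear_map_commutator:
  assumes "bilinear_map s s m"
  shows "bilinear_map s s (commutator m)"
proof -
  interpret vector_space s
    using assms by (simp add: bilinear_map_def Vector_Spaces.linear_iff)
  show ?thesis
    unfolding bilinear_map_def Vector_Spaces.linear_iff commutator_def
    by (simp add: vector_space_axioms bilinear_map_simps[OF assms] scale_right_diff_distrib)
qed

lemma left_symmetric_imp_lie_admissible:
  assumes "left_symmetric s m"
  shows "lie_admissible s m"
proof -
  have bil: "bilinear_map s s m" and ass: "associator m u v w = associator m v u w" for u v w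
    using assms unfolding left_symmetric_def by auto
  have jacobi: "commutator m u (commutator m v w) + commutator m v (commutator m w u)
      + commutator m w (commutator m u v) = 0" for u v w
  proof -
    \<comment> \<open>The Jacobi sum is the alternating sum of associators, whose terms cancel in pairs.\<close>
    have "m (m a b) d = m a (m b d) + m (m b a) d - m b (m a d)" for a b d
      using ass[of a b d] unfolding associator_def by (simp add: algebra_simps)
    from this[of u v w] this[of v w u] this[of w u v] show ?thesis
      unfolding commutator_def bilinear_map_simps[OF bil]
      by (simp only:) (simp add: algebra_simps)
  qed
  show ?thesis
    unfolding lie_admissible_def lie_algebra_def
    using bil bilinear_map_commutator[OF bil] jacobi by (simp add: commutator_def)
qed

section \<open>Orthogonal complements\<close>

lemma (in vector_space) subspace_perp:
  assumes "bilinear_map scale (*) \<omega>"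
  shows "subspace (perp \<omega> F)"
  unfolding subspace_def perp_def by (simp add: bilinear_map_simps[OF assms])

text \<open>
  For a basis \<open>B\<close> of \<open>F\<close> consider \<open>x \<mapsto> (\<Sum>b\<in>B. \<omega>(x,b) b)\<close>. Its kernel is the orthogonal complement
  of \<open>F\<close>, so it is injective on \<open>F\<close> and hence, by dimension, maps \<open>F\<close> onto \<open>F\<close>. An element of
  \<open>F\<close> with the same image as \<open>x\<close> is the component of \<open>x\<close> in \<open>F\<close>.
\<close>

lemma (in finite_dimensional_vector_space) orthogonal_decomposition:
  assumes bil: "bilinear_map scale (*) \<omega>"
    and nd: "nondegenerate_subspace scale \<omega> F"
  obtains f g where "f \<in> F" "g \<in> perp \<omega> F" "x = f + g"
proof -
  have F: "subspace F" "F \<inter> perp \<omega> F = {0}"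
    using nd unfolding nondegenerate_subspace_def by auto
  obtain B where B: "B \<subseteq> F" "independent B" "F \<subseteq> span B"
    by (rule basis_exists)
  have fin: "finite B" using B(2) by (rule finiteI_independent)
  have FB: "F = span B" using B F(1) span_minimal[of B F] by blast
  define \<phi> where "\<phi> x = (\<Sum>b\<in>B. scale (\<omega> x b) b)" for x
  have lin: "Vector_Spaces.linear scale scale \<phi>"
    unfolding Vector_Spaces.linear_iff \<phi>_def
    by (simp add: vector_space_axioms bilinear_map_simps[OF bil] scale_left_distrib
        sum.distrib scale_sum_right)
  interpret \<phi>: Vector_Spaces.linear scale scale \<phi> by (rule lin)
  have ker: "y \<in> perp \<omega> F" if "\<phi> y = 0" for y
  proof -
    have *: "\<omega> y b = 0" if "b \<in> B" for b
      using independentD[OF B(2) fin order_refl _ that] \<open>\<phi> y = 0\<close> unfolding \<phi>_def by blast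
    have "\<omega> y z = 0" if "z \<in> span B" for z
      using that
      by (induction rule: span_induct_alt) (simp_all add: bilinear_map_simps[OF bil] *)
    then show ?thesis unfolding perp_def FB by blast
  qed
  have inj: "inj_on \<phi> F"
    using \<phi>.inj_on_iff_eq_0[OF F(1)] ker F(2) by blast
  interpret pair: finite_dimensional_vector_space_pair_1 scale Basis scale by unfold_locales
  have "dim (\<phi> ` F) = dim F"
    using pair.dim_image_eq[OF lin, of F] inj F(1) span_eq_iff[of F] by metis
  moreover have "\<phi> y \<in> F" for y
    unfolding \<phi>_def using B(1) F(1) by (intro subspace_sum subspace_scale) auto
  ultimately have onto: "\<phi> ` F = F"
    by (intro subspace_dim_equal \<phi>.subspace_image F(1)) auto
  have "\<phi> x \<in> \<phi> ` F" using \<open>\<And>y. \<phi> y \<in> F\<close> onto by simp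
  then obtain f where f: "f \<in> F" "\<phi> x = \<phi> f" by blast
  have "x - f \<in> perp \<omega> F" by (rule ker) (simp add: \<phi>.diff f(2))
  then show ?thesis using that[of f "x - f"] f(1) by simp
qed

section \<open>Pre-symplectic left-symmetric algebras\<close>

locale presymplectic_lsa = finite_dimensional_vector_space s Basis
  for s :: "'k::field_char_0 \<Rightarrow> 'v::ab_group_add \<Rightarrow> 'v" and Basis :: "'v set" +
  fixes m :: "'v \<Rightarrow> 'v \<Rightarrow> 'v"  (infixl \<open>\<bullet>\<close> 70)
    and \<omega> :: "'v \<Rightarrow> 'v \<Rightarrow> 'k"
  assumes presymplectic: "presymplectic_left_symmetric s (\<bullet>) \<omega>"
begin

lemma lsa: "left_symmetric s (\<bullet>)"
  and form: "nondegenerate_skew_form s \<omega>"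
  and symmetric_left_mult: "\<omega> (u \<bullet> v) w = \<omega> v (u \<bullet> w)"
  using presymplectic
  unfolding presymplectic_left_symmetric_def symmetric_endo_def L_op_def by auto

lemma bilinear_product: "bilinear_map s s (\<bullet>)"
  using lsa unfolding left_symmetric_def by simp

lemma bilinear_form: "bilinear_map s (*) \<omega>"
  and skew: "\<omega> u v = - \<omega> v u"
  and nondegenerate: "(\<And>v. \<omega> u v = 0) \<Longrightarrow> u = 0"
  using form unfolding nondegenerate_skew_form_def by (simp, metis, metis)

lemmas product_simps = bilinear_map_simps[OF bilinear_product]
lemmas form_simps = bilinear_map_simps[OF bilinear_form]

lemma left_mult_commutator: "commutator (\<bullet>) u v \<bullet> w = u \<bullet> (v \<bullet> w) - v \<bullet> (u \<bullet> w)"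
  using lsa unfolding left_symmetric_def associator_def commutator_def product_simps
  by (simp add: algebra_simps)

text \<open>
  As an operator in \<open>w\<close>, the product \<open>[u,v] w\<close> is symmetric, being a left multiplication, and
  skew, being a commutator of symmetric operators.
\<close>

lemma left_mult_commutator_zero: "commutator (\<bullet>) u v \<bullet> w = 0"
proof (rule nondegenerate)
  fix z
  let ?c = "commutator (\<bullet>) u v"
  have "\<omega> (?c \<bullet> w) z = \<omega> w (v \<bullet> (u \<bullet> z)) - \<omega> w (u \<bullet> (v \<bullet> z))"
    unfolding left_mult_commutator form_simps symmetric_left_mult by simp
  also have "\<dots> = - \<omega> w (?c \<bullet> z)"
    unfolding left_mult_commutator form_simps by simp
  also have "\<dots> = - \<omega> (?c \<bullet> w) z" by (simp add: symmetric_left_mult)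
  finally show "\<omega> (?c \<bullet> w) z = 0" by simp
qed

lemma left_mult_commutator_span:
  assumes "c \<in> commutator_span s (\<bullet>)"
  shows "c \<bullet> w = 0"
  using assms unfolding commutator_span_def
  by (induction rule: span_induct_alt)
    (auto simp: product_simps left_mult_commutator_zero)

lemma commutator_in_span: "commutator (\<bullet>) u v \<in> commutator_span s (\<bullet>)"
  unfolding commutator_span_def by (rule span_base) blast

lemma commutator_span_left_ideal:
  assumes "c \<in> commutator_span s (\<bullet>)"
  shows "u \<bullet> c \<in> commutator_span s (\<bullet>)"
  using commutator_in_span[of u c] left_mult_commutator_span[OF assms]
  by (simp add: commutator_def)

lemma perp_left_ideal:
  assumes "x \<in> perp \<omega> (commutator_span s (\<bullet>))"
  shows "u \<bullet> x \<in> perp \<omega> (commutator_span s (\<bullet>))"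
  using assms commutator_span_left_ideal unfolding perp_def by (simp add: symmetric_left_mult)

end

section \<open>The nondegenerate case\<close>

locale presymplectic_lsa_nondegenerate = presymplectic_lsa +
  assumes nondegenerate_commutators:
    "nondegenerate_subspace s \<omega> (commutator_span s (\<bullet>))"
begin

abbreviation C where "C \<equiv> commutator_span s (\<bullet>)"
abbreviation J where "J \<equiv> perp \<omega> C"

lemma subspace_C: "subspace C" and C_Int_J: "C \<inter> J = {0}"
  using nondegenerate_commutators unfolding nondegenerate_subspace_def by auto

lemma decompose: obtains c j where "c \<in> C" "j \<in> J" "x = c + j"
  by (rule orthogonal_decomposition[OF bilinear_form nondegenerate_commutators])

lemma perp_product_commute:
  assumes "x \<in> J" "y \<in> J"
  shows "x \<bullet> y = y \<bullet> x"
proof -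
  have "commutator (\<bullet>) x y \<in> J"
    unfolding commutator_def
    using assms by (intro subspace_diff subspace_perp bilinear_form perp_left_ideal)
  then have "commutator (\<bullet>) x y = 0"
    using commutator_in_span C_Int_J by blast
  then show ?thesis by (simp add: commutator_def)
qed

text \<open>
  On \<open>J\<close> the form \<open>\<omega>(x y, z)\<close> is symmetric in \<open>x, y\<close> and skew in \<open>y, z\<close>. Alternating the two
  rules three times returns to the same arguments with a minus sign.
\<close>

lemma perp_product_zero:
  assumes "x \<in> J" "y \<in> J"
  shows "x \<bullet> y = 0"
proof -
  have flip: "\<omega> (a \<bullet> b) d = - \<omega> (a \<bullet> d) b" for a b d
    using symmetric_left_mult[of a b d] skew[of b "a \<bullet> d"] by simp
  have "\<omega> (x \<bullet> y) z = 0" if "z \<in> J" for z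
  proof -
    have "\<omega> (x \<bullet> y) z = - \<omega> (z \<bullet> x) y"
      using flip[of x y z] perp_product_commute[OF assms(1) that] by simp
    also have "\<dots> = \<omega> (y \<bullet> z) x"
      using flip[of z x y] perp_product_commute[OF that assms(2)] by simp
    also have "\<dots> = - \<omega> (x \<bullet> y) z"
      using flip[of y z x] perp_product_commute[OF assms] by simp
    finally show ?thesis by simp
  qed
  moreover have "\<omega> (x \<bullet> y) c = 0" if "c \<in> C" for c
    using perp_left_ideal[OF assms(2)] that unfolding perp_def by blast
  ultimately have "\<omega> (x \<bullet> y) w = 0" for w
    by (metis decompose form_simps(2) add_0)
  then show ?thesis by (rule nondegenerate)
qed

lemma product_eq_component:
  assumes "c \<in> C" "j \<in> J"
  shows "x \<bullet> (c + j) = x \<bullet> c"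
proof -
  obtain c' j' where "c' \<in> C" "j' \<in> J" "x = c' + j'" by (rule decompose)
  then show ?thesis
    using assms by (simp add: product_simps left_mult_commutator_span perp_product_zero)
qed

lemma product_perp: "j \<in> J \<Longrightarrow> x \<bullet> j = 0"
  using product_eq_component[of 0 j x] subspace_0[OF subspace_C] by (simp add: product_simps)

lemma product_in_C: "x \<bullet> y \<in> C"
  by (metis decompose product_eq_component commutator_span_left_ideal)

lemma product_span_eq: "product_span s (\<bullet>) = C"
proof
  show "product_span s (\<bullet>) \<subseteq> C"
    unfolding product_span_def using product_in_C by (intro span_minimal subspace_C) auto
  have "commutator (\<bullet>) u v \<in> product_span s (\<bullet>)" for u v
    unfolding product_span_def commutator_def by (intro span_diff span_base) auto
  then show "C \<subseteq> product_span s (\<bullet>)"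
    unfolding commutator_span_def product_span_def by (intro span_minimal) auto
qed

lemma milnor: "milnor_presymplectic s (\<bullet>) \<omega> C"
  unfolding milnor_presymplectic_def two_sided_ideal_def symmetric_endo_def L_op_def
  using bilinear_product form left_symmetric_imp_lie_admissible[OF lsa] subspace_C product_in_C
    nondegenerate_commutators product_span_eq left_mult_commutator_span subspace_0
  by (auto simp: symmetric_left_mult)

lemma direct_sum: "is_direct_sum s C J"
  unfolding is_direct_sum_def
  using subspace_C subspace_perp[OF bilinear_form] C_Int_J decompose by blast

text \<open>
  Let \<open>u\<close> be central. Its products with \<open>J\<close> vanish since \<open>J\<close> is annihilated from the left by
  everything, and its products with \<open>C\<close> vanish since \<open>u c = c u = 0\<close> for \<open>c\<close> in \<open>C\<close>.
\<close>

lemma lie_center_eq: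
  "lie_center (commutator (\<bullet>)) = {u. L_op (\<bullet>) u = (\<lambda>_. 0) \<and> R_op (\<bullet>) u = (\<lambda>_. 0)}"
proof -
  have "u \<bullet> v = 0 \<and> v \<bullet> u = 0" if "\<And>v. u \<bullet> v = v \<bullet> u" for u v
  proof -
    obtain c j where "c \<in> C" "j \<in> J" "v = c + j" by (rule decompose)
    then have "u \<bullet> v = c \<bullet> u"
      using that[of c] by (simp add: product_eq_component)
    also have "\<dots> = 0" by (rule left_mult_commutator_span) fact
    finally show ?thesis using that[of v] by metis
  qed
  then show ?thesis
    unfolding lie_center_def commutator_def L_op_def R_op_def fun_eq_iff right_minus_eq
    by (intro Collect_cong) metis
qed

lemma novikov: "novikov s (\<bullet>)"
  unfolding novikov_def using lsa left_mult_commutator_span[OF product_in_C] by simp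

end

theorem theorem2p11:
  fixes s :: "'k::field_char_0 \<Rightarrow> 'v::ab_group_add \<Rightarrow> 'v"
    and Basis :: "'v set"
    and m :: "'v \<Rightarrow> 'v \<Rightarrow> 'v"  (infixl \<open>\<bullet>\<close> 70)
    and \<omega> :: "'v \<Rightarrow> 'v \<Rightarrow> 'k"
  assumes "finite_dimensional_vector_space s Basis"
    and "presymplectic_left_symmetric s (\<bullet>) \<omega>"
    and "nondegenerate_subspace s \<omega> (commutator_span s (\<bullet>))"
  shows "product_span s (\<bullet>) = commutator_span s (\<bullet>) \<and>
    (let I = product_span s (\<bullet>); J = perp \<omega> I in
       milnor_presymplectic s (\<bullet>) \<omega> I \<and>
       ((\<forall>u\<in>I. \<forall>v\<in>I. u \<bullet> v = 0) \<and> (\<forall>u\<in>J. \<forall>v\<in>J. u \<bullet> v = 0) \<and>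
        abelian_lie_ideal s (commutator (\<bullet>)) I \<and> abelian_lie_subalgebra s (commutator (\<bullet>)) J) \<and>
       (is_direct_sum s I J \<and> (\<forall>u\<in>I. L_op (\<bullet>) u = (\<lambda>_. 0)) \<and>
        (\<forall>u\<in>J. L_op (\<bullet>) u = ad_op (\<bullet>) u)) \<and>
       lie_center (commutator (\<bullet>)) = {u. L_op (\<bullet>) u = (\<lambda>_. 0) \<and> R_op (\<bullet>) u = (\<lambda>_. 0)} \<and>
       novikov s (\<bullet>))"
proof -
  interpret presymplectic_lsa_nondegenerate s Basis m \<omega>
    using assms
    by (simp add: presymplectic_lsa_nondegenerate_def presymplectic_lsa_def
        presymplectic_lsa_axioms_def presymplectic_lsa_nondegenerate_axioms_def)
  have "abelian_lie_ideal s (commutator (\<bullet>)) C"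
    using subspace_C commutator_span_left_ideal left_mult_commutator_span
    by (auto simp: abelian_lie_ideal_def commutator_def)
  moreover have "abelian_lie_subalgebra s (commutator (\<bullet>)) J"
    using subspace_perp[OF bilinear_form, of C] subspace_0
    by (auto simp: abelian_lie_subalgebra_def commutator_def perp_product_zero)
  moreover have "\<forall>u\<in>J. L_op (\<bullet>) u = ad_op (\<bullet>) u"
    by (simp add: ad_op_def L_op_def R_op_def product_perp)
  moreover have "\<forall>u\<in>C. L_op (\<bullet>) u = (\<lambda>_. 0)"
    by (simp add: L_op_def left_mult_commutator_span)
  ultimately show ?thesis
    unfolding product_span_eq Let_def
    using milnor direct_sum lie_center_eq novikov left_mult_commutator_span perp_product_zero
    by blast
qed

end
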